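(* Let $C_1=(\mathcal{F},\mathbb{F},\mathbb{K},\kappa_1)$ and $C_2=(\mathcal{F},\mathbb{F},\mathbb{K},\kappa_2)$ be two classifiers on the same features, feature space and set of classes. Then $C_1$ is predictive equivalent to $C_2$ if and only if for every instance $(\mathbf{v},c)$, with $\mathbf{v}\in\mathbb{F}$ and $c=\kappa_1(\mathbf{v})$, one has $\mathbb{A}(C_1,c)=\mathbb{A}(C_2,c)$.
   Context: Features are $\mathcal{F}=\{1,\dots,m\}$; feature $i$ has a domain $\mathbb{D}_i$ (categorical or ordinal); feature space is $\mathbb{F}=\mathbb{D}_1\times\cdots\times\mathbb{D}_m$; $\mathbb{K}$ is a finite set of classes. A classifier $C=(\mathcal{F},\mathbb{F},\mathbb{K},\kappa)$ computes a function $\kappa:\mathbb{F}\to\mathbb{K}$. $C_1$ and $C_2$ are predictive equivalent if $\kappa_1(\mathbf{x})=\kappa_2(\mathbf{x})$ for all $\mathbf{x}\in\mathbb{F}$. A literal on feature $i$ is either $x_i\in R_i$ with $R_i\subseteq\mathbb{D}_i$, or $x_i\ \mathsf{op}\ v_i$ with $v_i\in\mathbb{D}_i$ and $\mathsf{op}\in\{=,<,\le,\ge,>\}$ (order relations for ordinal domains). Let $\mathbb{L}$ be the set of all literals. A partial assignment is a set $\mathcal{A}\subseteq\mathbb{L}$; $\mathsf{dom}(\mathcal{A})$ is the set of points of $\mathbb{F}$ at which all literals in $\mathcal{A}$ hold; $\mathcal{A}$ is consistent if $\mathsf{dom}(\mathcal{A})\neq\emptyset$. A partial assignment $\mathcal{A}$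 is a weak abductive explanation (WAXp) for class $c$ and classifier $C$ if $\kappa(\mathbf{x})=c$ for all $\mathbf{x}\in\mathsf{dom}(\mathcal{A})$. An abductive explanation (AXp) for $c$ is a subset-minimal WAXp, i.e. a WAXp for $c$ no proper subset of which is a WAXp for $c$. $\mathbb{A}(C,c)$ denotes the set of all consistent partial assignments $\mathcal{A}\subseteq\mathbb{L}$ that are AXps for class $c$ and classifier $C$. *)

theory Defs
  imports Main "HOL-Library.FuncSet"
begin

text \<open>
  All feature values live in one type \<open>'v\<close>; each feature has its own domain, a subset of
  \<open>'v\<close>, and each ordinal feature its own order.  The selector \<open>order_of\<close> is unspecified
  for a categorical domain: order literals on such a domain are excluded from the set of literals.
\<close>

datatype 'v feature_domain =
    is_Categorical: Categorical (values_of: "'v set")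
  | is_Ordinal: Ordinal (values_of: "'v set") (order_of: "'v rel")

definition valid_domain :: "'v feature_domain \<Rightarrow> bool" where
  "valid_domain D \<longleftrightarrow> (is_Ordinal D \<longrightarrow> linear_order_on (values_of D) (order_of D))"

record ('v, 'k) classifier =
  num_features :: nat
  feature_domain :: "nat \<Rightarrow> 'v feature_domain"
  classes :: "'k set"
  kappa :: "(nat \<Rightarrow> 'v) \<Rightarrow> 'k"

definition features :: "('v, 'k) classifier \<Rightarrow> nat set" where
  "features C = {1..num_features C}"

definition feature_space :: "('v, 'k) classifier \<Rightarrow> (nat \<Rightarrow> 'v) set" where
  "feature_space C = (\<Pi>\<^sub>E i\<in>features C. values_of (feature_domain C i))"

definition is_classifier :: "('v, 'k) classifier \<Rightarrow> bool" where
  "is_classifier C \<longleftrightarrow>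
     (\<forall>i\<in>features C. valid_domain (feature_domain C i)) \<and>
     finite (classes C) \<and>
     kappa C \<in> feature_space C \<rightarrow> classes C"

text \<open>Meant for classifiers on the same feature space.\<close>

definition predictive_equivalent :: "('v, 'k) classifier \<Rightarrow> ('v, 'k) classifier \<Rightarrow> bool" where
  "predictive_equivalent C1 C2 \<longleftrightarrow> (\<forall>x\<in>feature_space C1. kappa C1 x = kappa C2 x)"

datatype relop = EQ | LT | LE | GE | GT

text \<open>
  Literals are syntactic: for instance \<open>Member i {v}\<close> and \<open>Compare i EQ v\<close> are different
  literals with the same meaning, which matters for subset-minimality.
\<close>

datatype 'v literal = Member nat "'v set" | Compare nat relop 'v

definition literals :: "('v, 'k) classifier \<Rightarrow> 'v literal set" where
  "literals C =
     {Member i R | i R. i \<in> features C \<and> R \<subseteq> values_of (feature_domain C i)} \<union>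
     {Compare i rop v | i rop v. i \<in> features C \<and> v \<in> values_of (feature_domain C i) \<and>
        (rop = EQ \<or> is_Ordinal (feature_domain C i))}"

fun compare_values :: "'v rel \<Rightarrow> relop \<Rightarrow> 'v \<Rightarrow> 'v \<Rightarrow> bool" where
  "compare_values r EQ a b \<longleftrightarrow> a = b"
| "compare_values r LT a b \<longleftrightarrow> (a, b) \<in> r \<and> a \<noteq> b"
| "compare_values r LE a b \<longleftrightarrow> (a, b) \<in> r"
| "compare_values r GE a b \<longleftrightarrow> (b, a) \<in> r"
| "compare_values r GT a b \<longleftrightarrow> (b, a) \<in> r \<and> a \<noteq> b"

fun holds_at :: "('v, 'k) classifier \<Rightarrow> (nat \<Rightarrow> 'v) \<Rightarrow> 'v literal \<Rightarrow> bool" where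
  "holds_at C x (Member i R) \<longleftrightarrow> x i \<in> R"
| "holds_at C x (Compare i rop v) \<longleftrightarrow>
     compare_values (order_of (feature_domain C i)) rop (x i) v"

definition partial_assignment :: "('v, 'k) classifier \<Rightarrow> 'v literal set \<Rightarrow> bool" where
  "partial_assignment C A \<longleftrightarrow> A \<subseteq> literals C"

definition assignment_dom :: "('v, 'k) classifier \<Rightarrow> 'v literal set \<Rightarrow> (nat \<Rightarrow> 'v) set" where
  "assignment_dom C A = {x \<in> feature_space C. \<forall>l\<in>A. holds_at C x l}"

definition consistent :: "('v, 'k) classifier \<Rightarrow> 'v literal set \<Rightarrow> bool" where
  "consistent C A \<longleftrightarrow> assignment_dom C A \<noteq> {}"

definition WAXp :: "('v, 'k) classifier \<Rightarrow> 'k \<Rightarrow> 'v literal set \<Rightarrow> bool" where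
  "WAXp C c A \<longleftrightarrow> partial_assignment C A \<and> (\<forall>x\<in>assignment_dom C A. kappa C x = c)"

definition AXp :: "('v, 'k) classifier \<Rightarrow> 'k \<Rightarrow> 'v literal set \<Rightarrow> bool" where
  "AXp C c A \<longleftrightarrow> WAXp C c A \<and> (\<forall>B. B \<subset> A \<longrightarrow> \<not> WAXp C c B)"

definition consistent_AXps :: "('v, 'k) classifier \<Rightarrow> 'k \<Rightarrow> 'v literal set set" where
  "consistent_AXps C c = {A. partial_assignment C A \<and> consistent C A \<and> AXp C c A}"

definition is_instance :: "('v, 'k) classifier \<Rightarrow> (nat \<Rightarrow> 'v) \<times> 'k \<Rightarrow> bool" where
  "is_instance C = (\<lambda>(v, c). v \<in> feature_space C \<and> c = kappa C v)"

end

theory Submission imports Defs begin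

text \<open>
  Converse direction: fixing every coordinate to its value in a point \<open>v\<close> gives a finite
  assignment with domain \<open>{v}\<close>, hence a weak explanation of the class of \<open>v\<close>. By finiteness it
  contains a subset-minimal one, which still holds at \<open>v\<close> (so it is consistent); if it also
  explains the same class for the other classifier, the two predictions at \<open>v\<close> agree.
\<close>

lemma WAXp_imp_kappa_eq:
  assumes "WAXp C c A" and "v \<in> assignment_dom C A"
  shows "kappa C v = c"
  using assms by (simp add: WAXp_def)

lemma assignment_dom_antimono: "B \<subseteq> A \<Longrightarrow> assignment_dom C A \<subseteq> assignment_dom C B"
  by (auto simp: assignment_dom_def)

text \<open>A finite \<open>A\<close> has only finitely many subsets, so one is inclusion-minimal
  among those that are WAXps. Its proper subsets again lie in \<open>A\<close>, so minimality within
  \<open>A\<close> is minimality outright.\<close>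

lemma finite_WAXp_contains_AXp:
  assumes "finite A" and "WAXp C c A"
  obtains B where "B \<subseteq> A" and "AXp C c B"
proof -
  have "finite {B. B \<subseteq> A \<and> WAXp C c B}"
    using assms(1) by simp
  then obtain B where "B \<subseteq> A" "WAXp C c B"
    and "\<forall>B'. B' \<subseteq> A \<and> WAXp C c B' \<longrightarrow> B' \<subseteq> B \<longrightarrow> B = B'"
    using finite_has_minimal2[of "{B. B \<subseteq> A \<and> WAXp C c B}" A] assms(2) by auto
  then have "AXp C c B"
    unfolding AXp_def by blast
  with \<open>B \<subseteq> A\<close> show thesis
    by (rule that)
qed

definition point_assignment :: "('v, 'k) classifier \<Rightarrow> (nat \<Rightarrow> 'v) \<Rightarrow> 'v literal set" where
  "point_assignment C v = (\<lambda>i. Compare i EQ (v i)) ` features C"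

lemma finite_point_assignment: "finite (point_assignment C v)"
  by (simp add: point_assignment_def features_def)

lemma assignment_dom_point_assignment:
  assumes "v \<in> feature_space C"
  shows "assignment_dom C (point_assignment C v) = {v}"
proof -
  \<comment> \<open>Points are extensional functions, \<open>undefined\<close> outside
    \<open>features C\<close>, so agreement on the features is equality.\<close>
  have "x = v" if "x \<in> feature_space C" "\<forall>i\<in>features C. x i = v i" for x
    using that assms PiE_ext unfolding feature_space_def by blast
  then show ?thesis
    using assms by (auto simp: assignment_dom_def point_assignment_def)
qed

lemma WAXp_point_assignment:
  assumes "v \<in> feature_space C"
  shows "WAXp C (kappa C v) (point_assignment C v)"
proof -
  have "point_assignment C v \<subseteq> literals C"
    using assms by (auto simp: point_assignment_def literals_def feature_space_def)
  then show ?thesis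
    using assms by (simp add: WAXp_def partial_assignment_def assignment_dom_point_assignment)
qed

lemma exists_consistent_AXp_at_point:
  assumes "v \<in> feature_space C"
  obtains A where "A \<in> consistent_AXps C (kappa C v)" and "v \<in> assignment_dom C A"
proof -
  obtain A where A: "A \<subseteq> point_assignment C v" "AXp C (kappa C v) A"
    using finite_WAXp_contains_AXp[OF finite_point_assignment WAXp_point_assignment[OF assms]] .
  from A(1) have "v \<in> assignment_dom C A"
    using assignment_dom_antimono assignment_dom_point_assignment[OF assms] by blast
  moreover from this A(2) have "A \<in> consistent_AXps C (kappa C v)"
    unfolding consistent_AXps_def consistent_def AXp_def WAXp_def by blast
  ultimately show thesis
    using that by blast
qed

theorem theorem6:
  fixes m :: nat
    and D :: "nat \<Rightarrow> 'v feature_domain"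
    and K :: "'k set"
    and \<kappa>1 \<kappa>2 :: "(nat \<Rightarrow> 'v) \<Rightarrow> 'k"
    and C1 C2 :: "('v, 'k) classifier"
  assumes C1: "C1 = \<lparr>num_features = m, feature_domain = D, classes = K, kappa = \<kappa>1\<rparr>"
    and C2: "C2 = \<lparr>num_features = m, feature_domain = D, classes = K, kappa = \<kappa>2\<rparr>"
    and "is_classifier C1" and "is_classifier C2"
  shows "predictive_equivalent C1 C2 \<longleftrightarrow>
    (\<forall>v c. is_instance C1 (v, c) \<longrightarrow> consistent_AXps C1 c = consistent_AXps C2 c)"
proof -
  \<comment> \<open>The classifiers differ only in \<open>kappa\<close>, so all notions that do not
    mention it coincide.\<close>
  have space: "feature_space C1 = feature_space C2"
    by (simp add: C1 C2 feature_space_def features_def)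
  have lits: "literals C1 = literals C2"
    by (simp add: C1 C2 literals_def features_def)
  have holds: "holds_at C1 x l = holds_at C2 x l" for x l
    by (cases l) (simp_all add: C1 C2)
  have dom: "assignment_dom C1 A = assignment_dom C2 A" for A
    by (simp add: assignment_dom_def space holds)
  show ?thesis
  proof
    assume "predictive_equivalent C1 C2"
    \<comment> \<open>\<open>WAXp\<close> evaluates \<open>kappa\<close> only at points of the
      feature space, where both classifiers agree; this covers every \<open>c\<close>, attained or
      not.\<close>
    then have "WAXp C1 c A \<longleftrightarrow> WAXp C2 c A" for c A
      by (auto simp: predictive_equivalent_def WAXp_def partial_assignment_def lits space
          assignment_dom_def holds)
    then show "\<forall>v c. is_instance C1 (v, c) \<longrightarrow> consistent_AXps C1 c = consistent_AXps C2 c"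
      by (simp add: consistent_AXps_def AXp_def partial_assignment_def consistent_def lits dom)
  next
    assume same: "\<forall>v c. is_instance C1 (v, c) \<longrightarrow> consistent_AXps C1 c = consistent_AXps C2 c"
    show "predictive_equivalent C1 C2"
      unfolding predictive_equivalent_def
    proof
      fix v assume v: "v \<in> feature_space C1"
      then obtain A where A: "A \<in> consistent_AXps C1 (kappa C1 v)" "v \<in> assignment_dom C1 A"
        by (rule exists_consistent_AXp_at_point)
      from same v have "consistent_AXps C1 (kappa C1 v) = consistent_AXps C2 (kappa C1 v)"
        by (simp add: is_instance_def)
      with A(1) have "A \<in> consistent_AXps C2 (kappa C1 v)"
        by simp
      then have "WAXp C2 (kappa C1 v) A"
        by (simp add: consistent_AXps_def AXp_def)
      \<comment> \<open>\<open>A\<close> holds at \<open>v\<close> for \<open>C1\<close>;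
        \<open>dom\<close> carries this over to \<open>C2\<close>, whose prediction at
        \<open>v\<close> is then forced.\<close>
      then show "kappa C1 v = kappa C2 v"
        using WAXp_imp_kappa_eq[of C2 "kappa C1 v" A v] A(2) dom by simp
    qed
  qed
qed

end
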